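(* Let the norm $\|\cdot\|$ used at every stage (to define $D_t$, the distances and the Lipschitz constants) be the $l_\infty$ norm. Let $\delta_t\in[0,+\infty)$, $t=1,\dots,T$, be given and define $$\epsilon_t:=\begin{cases}0,& t=T-1,\\ \sum_{\tau=t}^{T-2}(M_{\tau+1}+\underline M_{\tau+1})\,\delta_{\tau+1}\,\lambda^{\tau-t},& 0\le t\le T-2.\end{cases}$$ Then the number of iterations performed by the DDP method to find a feasible policy $(x_1^k,\dots,x_T^k)$ satisfying both $$f_1(x_1^k)-f^*\le\epsilon_0\qquad\text{and}\qquad \sum_{t=1}^T\lambda^{t-1}h_t(x_t^k)-\underline f_1^{k-1}(x_1^k)\le\sum_{t=1}^T\lambda^{t-1}\epsilon_{t-1}$$ is bounded by $$\sum_{t=1}^{T-1}\Big(\frac{D_t}{\delta_t}+1\Big)^{n_t}+1 .$$ In particular, if $n_t\le n$, $D_t\le D$, $\max\{M_t,\underline M_t\}\le M$ and $\delta_t=\epsilon$ for all $t=1,\dots,T$ (with $\epsilon>0$), then the DDP method finds a feasible policy $(x_1^k,\dots,x_T^k)$ such that $$f_1(x_1^k)-f^*\le 2M\min\Big\{\frac1{1-\lambda},\,T-1\Big\}\,\epsilon,$$ $$\sum_{t=1}^T\lambda^{t-1}h_t(x_t^k)-\underline f_1^{k-1}(x_1^k)\le 2M\min\Big\{\frac1{(1-\lambda)^2},\,\frac{T(T-1)}2\Big\}\,\epsilon$$ within at most $(T-1)\big(\frac D\epsilon+1\big)^n+1$ iterations. (Here $1/(1-\lambda)=+\infty$ if $\lambda=1$;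 the iteration bound is regarded as $+\infty$ if some $\delta_t=0$ with $1\le t\le T-1$.)
   Context: **Problem.** $T\ge2$ is the number of stages, $\lambda\in(0,1]$ a discount factor. For $t=1,\dots,T$: $\bar X_t\subseteq\mathbb R^{n_t}$ is closed convex; $h_t$ is a closed convex objective function; $\phi_t=(\phi_{t,1},\dots,\phi_{t,p_t})$ has closed convex component functions on $\bar X_t$; $A_t:\mathbb R^{n_t}\to\mathbb R^{m_t}$, $B_t:\mathbb R^{n_{t-1}}\to\mathbb R^{m_t}$, $Q_t:\mathbb R^{n_{t-1}}\to\mathbb R^{p_t}$ are linear and $b_t\in\mathbb R^{m_t}$. For $t\ge2$, $X_t(x_{t-1}):=\{x\in\bar X_t: A_tx=B_tx_{t-1}+b_t,\ \phi_t(x)\le Q_tx_{t-1}\}$; $X_1:=\{x\in\bar X_1:A_1x=b_1,\phi_1(x)\le0\}$ and $X_1(x_0)\equiv X_1$. Value functions: $v_{T+1}\equiv0$, $f_t(x):=h_t(x)+\lambda v_{t+1}(x)$, $v_t(x_{t-1}):=\min_{x\in X_t(x_{t-1})}f_t(x)$ for $t=T,\dots,2$. The problem is $f^*:=\min_{x_1\in X_1}f_1(x_1)$. A feasible policy is $(x_1,\dots,x_T)$ with $x_t\in X_t(x_{t-1})$ for all $t$. **Effective regions.** $\mathcal X_1:=X_1$, $\mathcal X_t:=\bigcup_{x\in\mathcal X_{t-1}}X_t(x)$ for $t\ge2$; $\mathcal X_t(\epsilon):=\mathcal X_t+\{y\in\mathrm{Aff}(\mathcal X_t):\|y\|\le\epsilon\}$,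 where $\mathrm{Aff}$ denotes the affine hull (in the second summand, its direction space). **Standing assumptions.** (1) For each $t$ there is $D_t\ge0$ with $\|x-x'\|\le D_t$ for all $x,x'\in\mathcal X_t$. (2) For each $t$ there is $\bar\epsilon_t\in(0,\infty)$ with $h_t(x)<+\infty$ and (for $t\le T-1$) the relative interior of $X_{t+1}(x)$ nonempty, for all $x\in\mathcal X_t(\bar\epsilon_t)$. (3) $M_t\ge0$ satisfies $|f_t(x)-f_t(x')|\le M_t\|x-x'\|$ for all $x,x'\in\mathcal X_t$. **DDP method.** Set $\underline v_t^0\equiv-\infty$ for $t=2,\dots,T$ and $\underline v_{T+1}^k\equiv0$ for all $k\ge0$; write $\underline f_t^k(x):=h_t(x)+\lambda\underline v_{t+1}^k(x)$. Iteration $k=1,2,\dots$: Forward phase, $t=1,\dots,T$: $x_t^k\in\operatorname{Argmin}\{\underline f_t^{k-1}(x):x\in X_t(x_{t-1}^k)\}$ (if $k=1$ and $t<T$ the objective is $-\infty$ and $x_t^1$ is any feasible point). Backward phase, $t=T,T-1,\dots,2$: $\tilde v_t^k(x_{t-1}^k)=\min\{\underline f_t^k(x):x\in X_t(x_{t-1}^k)\}$; $(\tilde v_t^k)'(x_{t-1}^k)=[B_t,Q_t]y_t^k$ with $y_t^k$ an optimal dual multiplier of this problem (read with the appropriate adjoints/signs, so that it is a subgradient at $x_{t-1}^k$ of $\tilde v_t^k(x):=\min\{\underline f_t^k(y):y\in X_t(x)\}$); $\underline v_t^k(x)=\max\{\underline v_t^{k-1}(x),\ \tilde v_t^k(x_{t-1}^k)+\langle(\tilde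 v_t^k)'(x_{t-1}^k),x-x_{t-1}^k\rangle\}$. The minimizers and multipliers used are taken to exist (the paper regards this as ensured by assumption (2)). **Constants.** $\underline M_t\ge0$ is a constant with $|\underline f_t^k(x)-\underline f_t^k(x')|\le\underline M_t\|x-x'\|$ for all $x,x'\in\mathcal X_t$ and all $k\ge1$. *)

theory Defs
  imports "HOL-Analysis.Analysis"
begin

text \<open>
  The decision spaces have stage-dependent dimensions. They are realised as coordinate subspaces
  of one Euclidean space: the stage-t space is the span of a set of basis vectors, its dimension
  is the cardinality of that set, and \<^const>\<open>infnorm\<close> restricted to it is the l-infinity norm.
  As the ambient type is arbitrary, every finite sequence of dimensions occurs.

  Linear maps are given by their rows: the i-th component of A_t x is the inner product of
  \<open>eqmat P t i\<close> and x, and likewise for B_t (\<open>linkmat\<close>) and Q_t (\<open>ineqlink\<close>). The numbers m_t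
  and p_t are \<open>n_eq P t\<close> and \<open>n_ineq P t\<close>; rows are numbered from 0.
\<close>

record 'a multistage =
  stages   :: nat
  discount :: real
  coords   :: "nat \<Rightarrow> 'a set"
  base_set :: "nat \<Rightarrow> 'a set"
  obj      :: "nat \<Rightarrow> 'a \<Rightarrow> ereal"
  n_eq     :: "nat \<Rightarrow> nat"
  eqmat    :: "nat \<Rightarrow> nat \<Rightarrow> 'a"
  linkmat  :: "nat \<Rightarrow> nat \<Rightarrow> 'a"
  eqrhs    :: "nat \<Rightarrow> nat \<Rightarrow> real"
  n_ineq   :: "nat \<Rightarrow> nat"
  ineq     :: "nat \<Rightarrow> nat \<Rightarrow> 'a \<Rightarrow> ereal"
  ineqlink :: "nat \<Rightarrow> nat \<Rightarrow> 'a"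

definition closed_convex_fun :: "'a::euclidean_space set \<Rightarrow> ('a \<Rightarrow> ereal) \<Rightarrow> bool" where
  "closed_convex_fun S f \<longleftrightarrow>
     (\<forall>x\<in>S. f x \<noteq> -\<infinity>) \<and>
     convex {(x, r). x \<in> S \<and> f x \<le> ereal r} \<and>
     closed {(x, r). x \<in> S \<and> f x \<le> ereal r}"

definition stage_dim :: "'a multistage \<Rightarrow> nat \<Rightarrow> nat" where
  "stage_dim P t = card (coords P t)"

definition convex_multistage :: "'a::euclidean_space multistage \<Rightarrow> bool" where
  "convex_multistage P \<longleftrightarrow>
     2 \<le> stages P \<and> 0 < discount P \<and> discount P \<le> 1 \<and>
     (\<forall>t\<in>{1..stages P}.
        coords P t \<subseteq> Basis \<and>
        base_set P t \<subseteq> span (coords P t) \<and> closed (base_set P t) \<and> convex (base_set P t) \<and>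
        closed_convex_fun (span (coords P t)) (obj P t) \<and>
        (\<forall>j<n_ineq P t. closed_convex_fun (base_set P t) (ineq P t j)))"

text \<open>The second argument is irrelevant at stage 1.\<close>

definition feas :: "'a::euclidean_space multistage \<Rightarrow> nat \<Rightarrow> 'a \<Rightarrow> 'a set" where
  "feas P t u =
     {x \<in> base_set P t.
        (\<forall>i<n_eq P t. eqmat P t i \<bullet> x = (if t = 1 then 0 else linkmat P t i \<bullet> u) + eqrhs P t i) \<and>
        (\<forall>j<n_ineq P t. ineq P t j x \<le> ereal (if t = 1 then 0 else ineqlink P t j \<bullet> u))}"

function value_fun :: "'a::euclidean_space multistage \<Rightarrow> nat \<Rightarrow> 'a \<Rightarrow> ereal" where
  "value_fun P t u =
     (if t > stages P then 0
      else (INF x\<in>feas P t u. obj P t x + ereal (discount P) * value_fun P (Suc t) x))"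
  by pat_completeness auto
termination
  by (relation "Wellfounded.measure (\<lambda>(P, t, u). Suc (stages P) - t)") auto

declare value_fun.simps [simp del]

definition cost :: "'a::euclidean_space multistage \<Rightarrow> nat \<Rightarrow> 'a \<Rightarrow> ereal" where
  "cost P t x = obj P t x + ereal (discount P) * value_fun P (Suc t) x"

definition opt_value :: "'a::euclidean_space multistage \<Rightarrow> ereal" where
  "opt_value P = (INF x\<in>feas P 1 0. cost P 1 x)"

definition feasible_policy :: "'a::euclidean_space multistage \<Rightarrow> (nat \<Rightarrow> 'a) \<Rightarrow> bool" where
  "feasible_policy P x \<longleftrightarrow> (\<forall>t\<in>{1..stages P}. x t \<in> feas P t (x (t - 1)))"

text \<open>Stage 0 is the dummy initial point, so that the region at stage 1 is the first-stage
  feasible set.\<close>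

primrec eff_region :: "'a::euclidean_space multistage \<Rightarrow> nat \<Rightarrow> 'a set" where
  "eff_region P 0 = {0}"
| "eff_region P (Suc t) = (\<Union>u\<in>eff_region P t. feas P (Suc t) u)"

definition eff_region_enl :: "'a::euclidean_space multistage \<Rightarrow> nat \<Rightarrow> real \<Rightarrow> 'a set" where
  "eff_region_enl P t e =
     {x + (a - b) | x a b. x \<in> eff_region P t \<and>
        a \<in> affine hull (eff_region P t) \<and> b \<in> affine hull (eff_region P t) \<and>
        infnorm (a - b) \<le> e}"

definition bounded_regions :: "'a::euclidean_space multistage \<Rightarrow> (nat \<Rightarrow> real) \<Rightarrow> bool" where
  "bounded_regions P D \<longleftrightarrow>
     (\<forall>t\<in>{1..stages P}. 0 \<le> D t \<and>
        (\<forall>x\<in>eff_region P t. \<forall>x'\<in>eff_region P t. infnorm (x - x') \<le> D t))"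

definition regular_recourse :: "'a::euclidean_space multistage \<Rightarrow> bool" where
  "regular_recourse P \<longleftrightarrow>
     (\<forall>t\<in>{1..stages P}. \<exists>e>0. \<forall>x\<in>eff_region_enl P t e.
        obj P t x < \<infinity> \<and> (t < stages P \<longrightarrow> rel_interior (feas P (Suc t) x) \<noteq> {}))"

text \<open>Being bounded by a real number, the left-hand side forces the values to be finite.\<close>

definition infnorm_lipschitz_on :: "'a::euclidean_space set \<Rightarrow> real \<Rightarrow> ('a \<Rightarrow> ereal) \<Rightarrow> bool" where
  "infnorm_lipschitz_on S L f \<longleftrightarrow>
     0 \<le> L \<and> (\<forall>x\<in>S. \<forall>x'\<in>S. \<bar>f x - f x'\<bar> \<le> ereal (L * infnorm (x - x')))"

definition lagrangian ::
  "'a::euclidean_space multistage \<Rightarrow> nat \<Rightarrow> 'a \<Rightarrow> ('a \<Rightarrow> ereal) \<Rightarrow>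
     (nat \<Rightarrow> real) \<Rightarrow> (nat \<Rightarrow> real) \<Rightarrow> 'a \<Rightarrow> ereal" where
  "lagrangian P t u F y z x =
     F x
     + ereal (\<Sum>i<n_eq P t. y i * (linkmat P t i \<bullet> u + eqrhs P t i - eqmat P t i \<bullet> x))
     + (\<Sum>j<n_ineq P t. ereal (z j) * (ineq P t j x - ereal (ineqlink P t j \<bullet> u)))"

text \<open>
  Optimality of a multiplier (y, z) for the problem of minimising F over the stage-t feasible set:
  dual feasibility, and equality of the dual and the primal value (so by weak duality the dual
  function is maximal there). The dual function is taken over the points where all constraint
  functions are finite, so no product of 0 and infinity enters. Only stages from 2 on are used.
\<close>

definition optimal_multiplier ::
  "'a::euclidean_space multistage \<Rightarrow> nat \<Rightarrow> 'a \<Rightarrow> ('a \<Rightarrow> ereal) \<Rightarrow>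
     (nat \<Rightarrow> real) \<Rightarrow> (nat \<Rightarrow> real) \<Rightarrow> bool" where
  "optimal_multiplier P t u F y z \<longleftrightarrow>
     (\<forall>j<n_ineq P t. 0 \<le> z j) \<and>
     (INF x\<in>{x \<in> base_set P t. \<forall>j<n_ineq P t. ineq P t j x < \<infinity>}. lagrangian P t u F y z x)
       = (INF x\<in>feas P t u. F x)"

text \<open>
  The derivative of the Lagrangian with respect to u, that is, the transpose of B_t applied to y
  minus the transpose of Q_t applied to z; at an optimal multiplier it is a subgradient at u of
  the optimal value as a function of u.
\<close>

definition cut_slope ::
  "'a::euclidean_space multistage \<Rightarrow> nat \<Rightarrow> (nat \<Rightarrow> real) \<Rightarrow> (nat \<Rightarrow> real) \<Rightarrow> 'a" where
  "cut_slope P t y z =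
     (\<Sum>i<n_eq P t. y i *\<^sub>R linkmat P t i) - (\<Sum>j<n_ineq P t. z j *\<^sub>R ineqlink P t j)"

text \<open>\<open>vl k t\<close> is the lower model of the stage-t value function after k iterations.\<close>

definition model_cost ::
  "'a::euclidean_space multistage \<Rightarrow> (nat \<Rightarrow> nat \<Rightarrow> 'a \<Rightarrow> ereal) \<Rightarrow> nat \<Rightarrow> nat \<Rightarrow> 'a \<Rightarrow> ereal" where
  "model_cost P vl k t x = obj P t x + ereal (discount P) * vl k (Suc t) x"

text \<open>
  Iterates \<open>x k t\<close>, multipliers \<open>(y k t, z k t)\<close> and lower models produced by dual dynamic
  programming. In the first forward pass the objective is minus infinity on the feasible set for
  every t < T, so that any feasible point is a minimiser. The point \<open>x k 0\<close> is a dummy.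
\<close>

definition ddp_run ::
  "'a::euclidean_space multistage \<Rightarrow> (nat \<Rightarrow> nat \<Rightarrow> 'a) \<Rightarrow>
     (nat \<Rightarrow> nat \<Rightarrow> nat \<Rightarrow> real) \<Rightarrow> (nat \<Rightarrow> nat \<Rightarrow> nat \<Rightarrow> real) \<Rightarrow>
     (nat \<Rightarrow> nat \<Rightarrow> 'a \<Rightarrow> ereal) \<Rightarrow> bool" where
  "ddp_run P x y z vl \<longleftrightarrow>
     (\<forall>t\<in>{2..stages P}. \<forall>u. vl 0 t u = -\<infinity>) \<and>
     (\<forall>k u. vl k (Suc (stages P)) u = 0) \<and>
     (\<forall>k\<ge>1.
        (\<forall>t\<in>{1..stages P}.
           is_arg_min (model_cost P vl (k - 1) t) (\<lambda>w. w \<in> feas P t (x k (t - 1))) (x k t)) \<and>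
        (\<forall>t\<in>{2..stages P}.
           optimal_multiplier P t (x k (t - 1)) (model_cost P vl k t) (y k t) (z k t) \<and>
           (\<forall>u. vl k t u =
              max (vl (k - 1) t u)
                  ((INF w\<in>feas P t (x k (t - 1)). model_cost P vl k t w)
                   + ereal (cut_slope P t (y k t) (z k t) \<bullet> (u - x k (t - 1)))))))"

definition policy_gap ::
  "'a::euclidean_space multistage \<Rightarrow> (nat \<Rightarrow> nat \<Rightarrow> 'a) \<Rightarrow>
     (nat \<Rightarrow> nat \<Rightarrow> 'a \<Rightarrow> ereal) \<Rightarrow> nat \<Rightarrow> ereal" where
  "policy_gap P x vl k =
     (\<Sum>t=1..stages P. ereal (discount P ^ (t - 1)) * obj P t (x k t))
       - model_cost P vl (k - 1) 1 (x k 1)"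

definition eps_tol ::
  "'a multistage \<Rightarrow> (nat \<Rightarrow> real) \<Rightarrow> (nat \<Rightarrow> real) \<Rightarrow> (nat \<Rightarrow> real) \<Rightarrow> nat \<Rightarrow> real" where
  "eps_tol P M Ml \<delta> t =
     (if t = stages P - 1 then 0
      else \<Sum>\<tau>=t..stages P - 2. (M (\<tau> + 1) + Ml (\<tau> + 1)) * \<delta> (\<tau> + 1) * discount P ^ (\<tau> - t))"

text \<open>Least positive iteration number satisfying a criterion; infinity if there is none.\<close>

definition iterations_until :: "(nat \<Rightarrow> bool) \<Rightarrow> ereal" where
  "iterations_until C = (INF k\<in>{k. 1 \<le> k \<and> C k}. ereal (real k))"

definition iteration_bound ::
  "'a multistage \<Rightarrow> (nat \<Rightarrow> real) \<Rightarrow> (nat \<Rightarrow> real) \<Rightarrow> ereal" where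
  "iteration_bound P D \<delta> =
     (if \<exists>t\<in>{1..stages P - 1}. \<delta> t = 0 then \<infinity>
      else ereal ((\<Sum>t=1..stages P - 1. (D t / \<delta> t + 1) ^ stage_dim P t) + 1))"

end

theory Submission
  imports Defs
begin

text \<open>
  The lower models produced by dual dynamic programming increase with the iteration and stay below
  the value functions, because every cut is an instance of weak duality. Call the stage-t iterate
  of iteration k saturated if after that iteration the model of the next value function is within
  \<open>\<epsilon>\<^sub>t\<close> of the truth at this point, and covered if it lies within \<open>\<delta>\<^sub>t\<close> of a saturated stage-t
  iterate of an earlier iteration.

  If the stage-t iterate is covered, Lipschitz continuity of the true and of the approximate cost
  bounds the difference of the two costs there by
  \<open>\<lambda> \<epsilon>\<^sub>t + (M\<^sub>t + Ml\<^sub>t) \<delta>\<^sub>t = \<epsilon>\<^sub>t\<^sub>-\<^sub>1\<close>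
  (\<open>covered_imp_small_gap\<close>), and since the iterate minimises the approximate cost, the cut added in
  the backward phase makes the stage-(t-1) iterate saturated (\<open>small_gap_imp_saturated\<close>). At the
  last stage the two costs agree, so the recursion can always start.

  Hence there are two kinds of iterations. If all iterates at stages 1 to T-1 are covered, the cost
  differences are small at all stages. The one at stage 1 is the first termination criterion, as
  the first-stage model value is a lower bound of the optimal value; their discounted sum
  telescopes to the second one. Otherwise, the last stage that is not covered acquires a new
  saturated point at distance more than \<open>\<delta>\<^sub>t\<close> from the saturated points found before. By a
  packing bound for the l-infinity norm (\<open>card_separated_le\<close>) this happens at most
  \<open>(D\<^sub>t / \<delta>\<^sub>t + 1) ^ n\<^sub>t\<close> times at stage t. The uniform version follows by estimating the
  tolerances with geometric sums.
\<close>

section \<open>Elementary sums\<close>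

lemma geometric_sum_le:
  fixes q :: real
  assumes "0 \<le> q" "q \<le> 1"
  shows "(\<Sum>i<n. q ^ i) \<le> real n" and "q < 1 \<Longrightarrow> (\<Sum>i<n. q ^ i) \<le> 1 / (1 - q)"
proof -
  have "(\<Sum>i<n. q ^ i) \<le> (\<Sum>i<n. 1)"
    using assms by (intro sum_mono power_le_one) auto
  then show "(\<Sum>i<n. q ^ i) \<le> real n" by simp
  show "(\<Sum>i<n. q ^ i) \<le> 1 / (1 - q)" if "q < 1"
    using assms that by (auto simp: sum_gp_strict intro!: divide_right_mono)
qed

lemma sum_countdown: "(\<Sum>s<n. real (n - 1 - s)) = real (n * (n - 1)) / 2"
proof -
  have "(\<Sum>s<n. real (n - 1 - s)) = (\<Sum>s<n. real s)"
    using sum.nat_diff_reindex[of real n] by simp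
  also have "\<dots> = real (n * (n - 1)) / 2"
  proof (induction n)
    case (Suc n)
    then show ?case by (cases n) (simp_all add: field_simps)
  qed simp
  finally show ?thesis .
qed

section \<open>Packing in the l-infinity norm\<close>

lemma infnorm_le_if_coords_le:
  fixes x :: "'a::euclidean_space"
  assumes "\<And>i. i \<in> Basis \<Longrightarrow> \<bar>x \<bullet> i\<bar> \<le> r"
  shows "infnorm x \<le> r"
  unfolding infnorm_Max using assms by (subst Max_le_iff) auto

text \<open>
  Overlay a grid of mesh \<open>\<delta>\<close>, starting in every coordinate at the infimum over the set. Two points
  of one cell are closer than \<open>\<delta>\<close>, and along each axis only \<open>\<lfloor>D / \<delta>\<rfloor> + 1\<close> cells can be reached.
\<close>

lemma card_separated_le:
  fixes S C :: "'a::euclidean_space set" and \<delta> D :: real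
  assumes C: "C \<subseteq> Basis" and S: "S \<subseteq> span C" and \<delta>: "0 < \<delta>" and D: "0 \<le> D"
    and diam: "\<And>x x'. x \<in> S \<Longrightarrow> x' \<in> S \<Longrightarrow> infnorm (x - x') \<le> D"
    and sep: "\<And>x x'. x \<in> S \<Longrightarrow> x' \<in> S \<Longrightarrow> x \<noteq> x' \<Longrightarrow> \<delta> < infnorm (x - x')"
  shows "finite S \<and> real (card S) \<le> (D / \<delta> + 1) ^ card C"
proof -
  define m where "m i = (INF x\<in>S. x \<bullet> i)" for i
  define cell where "cell x = restrict (\<lambda>i. nat \<lfloor>(x \<bullet> i - m i) / \<delta>\<rfloor>) C" for x
  define N where "N = nat \<lfloor>D / \<delta>\<rfloor>"
  have finC: "finite C"
    using C finite_Basis finite_subset by blast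
  have coord: "\<bar>x \<bullet> i - x' \<bullet> i\<bar> \<le> D" if "x \<in> S" "x' \<in> S" "i \<in> Basis" for x x' i
    using Basis_le_infnorm[OF that(3), of "x - x'"] diam[OF that(1,2)] by (simp add: inner_diff_left)
  have m_le: "m i \<le> x \<bullet> i" if "x \<in> S" "i \<in> Basis" for x i
  proof -
    have "bdd_below ((\<lambda>x. x \<bullet> i) ` S)"
      by (rule bdd_belowI2[of _ "x \<bullet> i - D"]) (use coord[OF that(1) _ that(2)] in force)
    then show ?thesis
      unfolding m_def using that(1) by (rule cINF_lower)
  qed
  have m_ge: "x \<bullet> i - D \<le> m i" if "x \<in> S" "i \<in> Basis" for x i
    unfolding m_def by (rule cINF_greatest) (use that coord[OF that(1) _ that(2)] in force)+
  have inj: "inj_on cell S"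
  proof (rule inj_onI, rule ccontr)
    fix x x' assume x: "x \<in> S" "x' \<in> S" and eq: "cell x = cell x'" and ne: "x \<noteq> x'"
    have "\<bar>(x - x') \<bullet> i\<bar> \<le> \<delta>" if i: "i \<in> Basis" for i
    proof (cases "i \<in> C")
      case True
      have nonneg: "0 \<le> (x \<bullet> i - m i) / \<delta>" "0 \<le> (x' \<bullet> i - m i) / \<delta>"
        using m_le x i \<delta> by simp_all
      have "nat \<lfloor>(x \<bullet> i - m i) / \<delta>\<rfloor> = nat \<lfloor>(x' \<bullet> i - m i) / \<delta>\<rfloor>"
        using fun_cong[OF eq, of i] True by (simp add: cell_def)
      then have "\<lfloor>(x \<bullet> i - m i) / \<delta>\<rfloor> = \<lfloor>(x' \<bullet> i - m i) / \<delta>\<rfloor>"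
        using nonneg by (simp add: eq_nat_nat_iff)
      then have "\<bar>(x \<bullet> i - m i) / \<delta> - (x' \<bullet> i - m i) / \<delta>\<bar> < 1"
        by linarith
      then have "\<bar>(x \<bullet> i - x' \<bullet> i) / \<delta>\<bar> < 1"
        by (simp add: diff_divide_distrib)
      then show ?thesis
        using \<delta> by (simp add: inner_diff_left abs_divide)
    next
      case False
      have "x - x' \<in> span C"
        using S x by (blast intro: span_diff)
      moreover have "orthogonal i c" if "c \<in> C" for c
        using that C i False by (auto simp: orthogonal_def inner_Basis)
      ultimately have "orthogonal i (x - x')"
        by (rule orthogonal_to_span)
      then show ?thesis
        using \<delta> by (simp add: orthogonal_def inner_commute)
    qed
    then have "infnorm (x - x') \<le> \<delta>"
      by (rule infnorm_le_if_coords_le)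
    with sep[OF x ne] show False by simp
  qed
  have "cell x i \<le> N" if "x \<in> S" "i \<in> C" for x i
  proof -
    have "i \<in> Basis" using C that by auto
    then have "(x \<bullet> i - m i) / \<delta> \<le> D / \<delta>"
      using m_ge[OF that(1), of i] \<delta> by (intro divide_right_mono) auto
    then show ?thesis
      using that unfolding cell_def N_def by (simp add: floor_mono nat_mono)
  qed
  then have range: "cell ` S \<subseteq> C \<rightarrow>\<^sub>E {..N}"
    by (auto simp: cell_def)
  have finE: "finite (C \<rightarrow>\<^sub>E {..N})"
    using finC by (simp add: finite_PiE)
  have "card S \<le> card (C \<rightarrow>\<^sub>E {..N})"
    using inj range finE by (rule card_inj_on_le)
  also have "\<dots> = (N + 1) ^ card C"
    using finC by (simp add: card_PiE)
  finally have "real (card S) \<le> real ((N + 1) ^ card C)"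
    by (simp only: of_nat_le_iff)
  also have "\<dots> = (real N + 1) ^ card C"
    by (simp add: add.commute)
  also have "\<dots> \<le> (D / \<delta> + 1) ^ card C"
    using D \<delta> by (intro power_mono) (auto simp: N_def)
  finally show ?thesis
    using inj_on_finite[OF inj range finE] by simp
qed

section \<open>Cuts from dual multipliers\<close>

text \<open>
  Weak duality at a shifted right-hand side: for a point x feasible for u' the Lagrangian at u' is
  at most F x, and replacing u' by u changes it by the inner product of the cut slope with the
  difference.
\<close>

lemma cut_le_objective:
  fixes P :: "'a::euclidean_space multistage"
  assumes mult: "optimal_multiplier P t u F y z" and t: "t \<noteq> 1"
    and ineq: "\<And>j. j < n_ineq P t \<Longrightarrow> ineq P t j x \<noteq> -\<infinity>" and fin: "F x \<noteq> -\<infinity>"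
    and x: "x \<in> feas P t u'"
  shows "(INF w\<in>feas P t u. F w) + ereal (cut_slope P t y z \<bullet> (u' - u)) \<le> F x"
proof (cases "F x")
  case (real f)
  define g where "g j = real_of_ereal (ineq P t j x)" for j
  have xb: "x \<in> base_set P t"
    and eq: "\<And>i. i < n_eq P t \<Longrightarrow> eqmat P t i \<bullet> x = linkmat P t i \<bullet> u' + eqrhs P t i"
    and le: "\<And>j. j < n_ineq P t \<Longrightarrow> ineq P t j x \<le> ereal (ineqlink P t j \<bullet> u')"
    using x t by (auto simp: feas_def)
  have g: "ineq P t j x = ereal (g j)" "g j \<le> ineqlink P t j \<bullet> u'" if "j < n_ineq P t" for j
  proof -
    show *: "ineq P t j x = ereal (g j)"
      using ineq[OF that] le[OF that] by (cases "ineq P t j x") (auto simp: g_def)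
    show "g j \<le> ineqlink P t j \<bullet> u'"
      using le[OF that] by (simp add: *)
  qed
  have z: "0 \<le> z j" if "j < n_ineq P t" for j
    using mult that by (simp add: optimal_multiplier_def)
  have "(INF w\<in>feas P t u. F w)
      = (INF w\<in>{x \<in> base_set P t. \<forall>j<n_ineq P t. ineq P t j x < \<infinity>}. lagrangian P t u F y z w)"
    using mult by (simp add: optimal_multiplier_def)
  also have "\<dots> \<le> lagrangian P t u F y z x"
    by (rule INF_lower) (use xb g in auto)
  also have "\<dots> = ereal (f + (\<Sum>i<n_eq P t. y i * (linkmat P t i \<bullet> u + eqrhs P t i - eqmat P t i \<bullet> x))
      + (\<Sum>j<n_ineq P t. z j * (g j - ineqlink P t j \<bullet> u)))"
    by (simp add: lagrangian_def real g)
  also have "\<dots> = ereal (f + (\<Sum>i<n_eq P t. y i * (linkmat P t i \<bullet> (u - u')))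
      + (\<Sum>j<n_ineq P t. z j * (g j - ineqlink P t j \<bullet> u)))"
    by (simp add: eq inner_diff_right)
  finally have 1: "(INF w\<in>feas P t u. F w) \<le> \<dots>" .
  have "(\<Sum>j<n_ineq P t. z j * (g j - ineqlink P t j \<bullet> u))
      \<le> (\<Sum>j<n_ineq P t. z j * (ineqlink P t j \<bullet> (u' - u)))"
    using g(2) z by (intro sum_mono mult_left_mono) (auto simp: inner_diff_right)
  moreover have "cut_slope P t y z \<bullet> (u' - u)
      = - (\<Sum>i<n_eq P t. y i * (linkmat P t i \<bullet> (u - u')))
        - (\<Sum>j<n_ineq P t. z j * (ineqlink P t j \<bullet> (u' - u)))"
    by (simp add: cut_slope_def inner_diff_left inner_sum_left inner_diff_right algebra_simps
        sum_subtractf)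
  ultimately have 2: "(f + (\<Sum>i<n_eq P t. y i * (linkmat P t i \<bullet> (u - u')))
      + (\<Sum>j<n_ineq P t. z j * (g j - ineqlink P t j \<bullet> u))) + cut_slope P t y z \<bullet> (u' - u) \<le> f"
    by linarith
  have "(INF w\<in>feas P t u. F w) + ereal (cut_slope P t y z \<bullet> (u' - u))
     \<le> ereal (f + (\<Sum>i<n_eq P t. y i * (linkmat P t i \<bullet> (u - u')))
      + (\<Sum>j<n_ineq P t. z j * (g j - ineqlink P t j \<bullet> u))) + ereal (cut_slope P t y z \<bullet> (u' - u))"
    using 1 by (rule add_right_mono)
  also have "\<dots> \<le> F x"
    using 2 by (simp add: real)
  finally show ?thesis .
qed (use fin in auto)

section \<open>The lower models\<close>

lemma lipschitz_imp_finite: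
  assumes "infnorm_lipschitz_on S L f" "u \<in> S"
  shows "\<bar>f u\<bar> \<noteq> \<infinity>"
proof -
  have "\<bar>f u - f u\<bar> \<le> ereal (L * infnorm (u - u))"
    using assms by (simp only: infnorm_lipschitz_on_def)
  then show ?thesis by (cases "f u") auto
qed

locale ddp_method =
  fixes P :: "'a::euclidean_space multistage"
    and D M Ml \<delta> :: "nat \<Rightarrow> real"
    and x :: "nat \<Rightarrow> nat \<Rightarrow> 'a"
    and y z :: "nat \<Rightarrow> nat \<Rightarrow> nat \<Rightarrow> real"
    and vl :: "nat \<Rightarrow> nat \<Rightarrow> 'a \<Rightarrow> ereal"
  assumes problem: "convex_multistage P"
    and bounded: "bounded_regions P D"
    and cost_lipschitz: "\<And>t. t \<in> {1..stages P} \<Longrightarrow>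
      infnorm_lipschitz_on (eff_region P t) (M t) (cost P t)"
    and run: "ddp_run P x y z vl"
    and model_lipschitz: "\<And>t k. t \<in> {1..stages P} \<Longrightarrow> 1 \<le> k \<Longrightarrow>
      infnorm_lipschitz_on (eff_region P t) (Ml t) (model_cost P vl k t)"
    and \<delta>_nonneg: "\<And>t. t \<in> {1..stages P} \<Longrightarrow> 0 \<le> \<delta> t"
begin

abbreviation \<epsilon> :: "nat \<Rightarrow> real" where
  "\<epsilon> \<equiv> eps_tol P M Ml \<delta>"

lemma stages_ge_2: "2 \<le> stages P"
  and discount_pos: "0 < discount P"
  and discount_le_1: "discount P \<le> 1"
  using problem by (auto simp: convex_multistage_def)

lemma region_subset_base_set:
  assumes "t \<in> {1..stages P}"
  shows "eff_region P t \<subseteq> base_set P t"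
proof -
  obtain s where "t = Suc s" using assms by (cases t) auto
  then show ?thesis by (auto simp: feas_def)
qed

lemma base_set_subset_span: "t \<in> {1..stages P} \<Longrightarrow> base_set P t \<subseteq> span (coords P t)"
  using problem unfolding convex_multistage_def by blast

lemma region_subset_span:
  "t \<in> {1..stages P} \<Longrightarrow> eff_region P t \<subseteq> span (coords P t)"
  using region_subset_base_set base_set_subset_span by blast

lemma feas_subset_region:
  assumes "u \<in> eff_region P (t - 1)" "1 \<le> t"
  shows "feas P t u \<subseteq> eff_region P t"
  using assms by (cases t) auto

lemma iterate_minimises:
  assumes "1 \<le> k" "t \<in> {1..stages P}"
  shows iterate_feas: "x k t \<in> feas P t (x k (t - 1))"
    and iterate_le: "w \<in> feas P t (x k (t - 1)) \<Longrightarrow>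
      model_cost P vl (k - 1) t (x k t) \<le> model_cost P vl (k - 1) t w"
proof -
  have "is_arg_min (model_cost P vl (k - 1) t) (\<lambda>w. w \<in> feas P t (x k (t - 1))) (x k t)"
    using run assms unfolding ddp_run_def by blast
  then show "x k t \<in> feas P t (x k (t - 1))"
    and "w \<in> feas P t (x k (t - 1)) \<Longrightarrow>
      model_cost P vl (k - 1) t (x k t) \<le> model_cost P vl (k - 1) t w"
    by (auto simp: is_arg_min_def not_less)
qed

lemma feas_first_stage: "feas P 1 u = feas P 1 u'"
  by (simp add: feas_def)

lemma iterate_in_region:
  assumes "1 \<le> k" "t \<in> {1..stages P}"
  shows "x k t \<in> eff_region P t"
  using assms(2)
proof (induction t)
  case (Suc t)
  have feas: "x k (Suc t) \<in> feas P (Suc t) (x k t)"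
    using iterate_feas[OF assms(1) Suc.prems] by simp
  show ?case
  proof (cases "t = 0")
    case True
    have "x k 1 \<in> feas P 1 0"
      using feas feas_first_stage[of "x k 0" 0] by (simp only: True One_nat_def)
    then show ?thesis
      by (simp add: True)
  next
    case False
    then have "x k t \<in> eff_region P t"
      using Suc by simp
    with feas show ?thesis
      by (simp only: eff_region.simps) (rule UN_I)
  qed
qed simp

lemma cost_finite:
  "t \<in> {1..stages P} \<Longrightarrow> u \<in> eff_region P t \<Longrightarrow> \<bar>cost P t u\<bar> \<noteq> \<infinity>"
  using lipschitz_imp_finite[OF cost_lipschitz] .

lemma model_cost_finite:
  "t \<in> {1..stages P} \<Longrightarrow> 1 \<le> k \<Longrightarrow> u \<in> eff_region P t \<Longrightarrow> \<bar>model_cost P vl k t u\<bar> \<noteq> \<infinity>"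
  using lipschitz_imp_finite[OF model_lipschitz] .

lemma obj_finite:
  assumes "t \<in> {1..stages P}" "u \<in> eff_region P t"
  shows "\<bar>obj P t u\<bar> \<noteq> \<infinity>"
proof -
  have "obj P t u \<noteq> -\<infinity>"
    using problem assms(1) subsetD[OF region_subset_span[OF assms(1)] assms(2)]
    by (simp add: convex_multistage_def closed_convex_fun_def)
  then show ?thesis
    using cost_finite[OF assms] by (cases "obj P t u") (auto simp: cost_def)
qed

lemma value_finite:
  assumes "t \<in> {1..stages P}" "u \<in> eff_region P t"
  shows "\<bar>value_fun P (Suc t) u\<bar> \<noteq> \<infinity>"
  using cost_finite[OF assms] obj_finite[OF assms] discount_pos
  by (cases "obj P t u"; cases "value_fun P (Suc t) u") (auto simp: cost_def)

lemma model_finite: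
  assumes "t \<in> {1..stages P}" "1 \<le> k" "u \<in> eff_region P t"
  shows "\<bar>vl k (Suc t) u\<bar> \<noteq> \<infinity>"
  using model_cost_finite[OF assms] obj_finite[OF assms(1,3)] discount_pos
  by (cases "obj P t u"; cases "vl k (Suc t) u") (auto simp: model_cost_def)

lemma value_fun_eq:
  "t \<le> stages P \<Longrightarrow> value_fun P t u = (INF w\<in>feas P t u. cost P t w)"
  by (subst value_fun.simps) (simp add: cost_def)

lemma value_after_last: "value_fun P (Suc (stages P)) u = 0"
  by (subst value_fun.simps) simp

lemma model_after_last: "vl k (Suc (stages P)) u = 0"
  using run by (simp add: ddp_run_def)

lemma model_update:
  assumes "t \<in> {2..stages P}" "1 \<le> k"
  shows "vl k t u = max (vl (k - 1) t u)
     ((INF w\<in>feas P t (x k (t - 1)). model_cost P vl k t w)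
      + ereal (cut_slope P t (y k t) (z k t) \<bullet> (u - x k (t - 1))))"
  using run assms unfolding ddp_run_def by blast

lemma backward_multiplier:
  assumes "t \<in> {2..stages P}" "1 \<le> k"
  shows "optimal_multiplier P t (x k (t - 1)) (model_cost P vl k t) (y k t) (z k t)"
  using run assms unfolding ddp_run_def by blast

lemma model_mono:
  assumes "j \<le> k" "t \<in> {2..Suc (stages P)}"
  shows "vl j t u \<le> vl k t u"
  using assms(1)
proof (induction k rule: dec_induct)
  case (step k)
  have "vl k t u \<le> vl (Suc k) t u"
  proof (cases "t = Suc (stages P)")
    case True
    then show ?thesis by (simp add: model_after_last)
  next
    case False
    then show ?thesis
      using model_update[of t "Suc k" u] assms(2) by simp
  qed
  with step.IH show ?case by simp
qed simp

lemma model_cost_mono: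
  assumes "j \<le> k" "t \<in> {1..stages P}"
  shows "model_cost P vl j t u \<le> model_cost P vl k t u"
  unfolding model_cost_def using model_mono[OF assms(1), of "Suc t" u] assms(2) discount_pos
  by (intro add_left_mono ereal_mult_left_mono) auto

text \<open>
  Both kinds of cuts, inherited and new, are below the value function: the new ones by weak duality
  and because the model of the next stage is already known to be a lower bound. This is an induction
  on the iteration and, inside it, backwards on the stage.
\<close>

lemma model_le_value:
  assumes "t \<in> {1..stages P}" "u \<in> eff_region P t"
  shows "vl k (Suc t) u \<le> value_fun P (Suc t) u"
  using assms
proof (induction k arbitrary: t u)
  case 0
  show ?case
  proof (cases "t = stages P")
    case True
    then show ?thesis by (simp add: model_after_last value_after_last)
  next
    case False
    then have "vl 0 (Suc t) u = -\<infinity>"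
      using run 0 by (simp add: ddp_run_def)
    then show ?thesis by simp
  qed
next
  case (Suc k)
  have "t \<le> stages P" using Suc.prems by simp
  then show ?case
    using Suc.prems
  proof (induction t arbitrary: u rule: inc_induct)
    case base
    show ?case by (simp add: model_after_last value_after_last)
  next
    case (step t)
    have t: "Suc t \<in> {2..stages P}" "Suc t \<in> {1..stages P}" "t \<in> {1..stages P}"
      using step by auto
    have cut: "(INF w\<in>feas P (Suc t) (x (Suc k) t). model_cost P vl (Suc k) (Suc t) w)
        + ereal (cut_slope P (Suc t) (y (Suc k) (Suc t)) (z (Suc k) (Suc t)) \<bullet> (u - x (Suc k) t))
       \<le> cost P (Suc t) w" if w: "w \<in> feas P (Suc t) u" for w
    proof -
      have reg: "w \<in> eff_region P (Suc t)"
        using w step.prems by auto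
      have ineq: "ineq P (Suc t) j w \<noteq> -\<infinity>" if "j < n_ineq P (Suc t)" for j
      proof -
        have "w \<in> base_set P (Suc t)"
          using w by (simp add: feas_def)
        then show ?thesis
          using problem t(2) that unfolding convex_multistage_def closed_convex_fun_def by blast
      qed
      have mult: "optimal_multiplier P (Suc t) (x (Suc k) t) (model_cost P vl (Suc k) (Suc t))
          (y (Suc k) (Suc t)) (z (Suc k) (Suc t))"
        using backward_multiplier[OF t(1), of "Suc k"] by simp
      have "(INF w\<in>feas P (Suc t) (x (Suc k) t). model_cost P vl (Suc k) (Suc t) w)
        + ereal (cut_slope P (Suc t) (y (Suc k) (Suc t)) (z (Suc k) (Suc t)) \<bullet> (u - x (Suc k) t))
        \<le> model_cost P vl (Suc k) (Suc t) w"
        using mult _ ineq _ w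
        by (rule cut_le_objective) (use t model_cost_finite[OF t(2) _ reg, of "Suc k"] in auto)
      also have "\<dots> \<le> cost P (Suc t) w"
        unfolding model_cost_def cost_def using step.IH[OF t(2) reg] discount_pos
        by (intro add_left_mono ereal_mult_left_mono) auto
      finally show ?thesis .
    qed
    have "vl k (Suc t) u \<le> value_fun P (Suc t) u"
      using Suc.IH step.prems by simp
    moreover have "(INF w\<in>feas P (Suc t) (x (Suc k) t). model_cost P vl (Suc k) (Suc t) w)
        + ereal (cut_slope P (Suc t) (y (Suc k) (Suc t)) (z (Suc k) (Suc t)) \<bullet> (u - x (Suc k) t))
       \<le> value_fun P (Suc t) u"
      using cut t by (subst value_fun_eq) (auto intro: INF_greatest)
    ultimately show ?case
      using model_update[OF t(1), of "Suc k" u] by simp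
  qed
qed

lemma model_cost_le_cost:
  assumes "t \<in> {1..stages P}" "u \<in> eff_region P t"
  shows "model_cost P vl k t u \<le> cost P t u"
  unfolding model_cost_def cost_def using model_le_value[OF assms] discount_pos
  by (intro add_left_mono ereal_mult_left_mono) auto

text \<open>
  The point u is kept apart from the previous iterate for the sake of stage 1, where the feasible set
  is the same for all u but the dummy iterate need not be the dummy point 0 of the region.
\<close>

lemma iterate_model_cost_le_value:
  assumes "1 \<le> k" "t \<in> {1..stages P}" "u \<in> eff_region P (t - 1)"
    and "feas P t u = feas P t (x k (t - 1))"
  shows "model_cost P vl (k - 1) t (x k t) \<le> value_fun P t u"
proof -
  have "model_cost P vl (k - 1) t (x k t) \<le> cost P t w" if w: "w \<in> feas P t u" for w
  proof -
    have "model_cost P vl (k - 1) t (x k t) \<le> model_cost P vl (k - 1) t w"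
      using iterate_le[OF assms(1,2)] w assms(4) by simp
    also have "\<dots> \<le> cost P t w"
      using model_cost_le_cost feas_subset_region assms(2,3) w
      by (meson atLeastAtMost_iff subsetD)
    finally show ?thesis .
  qed
  then show ?thesis
    using assms(2) by (subst value_fun_eq) (auto intro: INF_greatest)
qed

section \<open>Saturated points and the propagation of gaps\<close>

definition saturated :: "nat \<Rightarrow> nat \<Rightarrow> bool" where
  "saturated t k \<longleftrightarrow> value_fun P (Suc t) (x k t) \<le> vl k (Suc t) (x k t) + ereal (\<epsilon> t)"

definition covered :: "nat \<Rightarrow> nat \<Rightarrow> bool" where
  "covered t k \<longleftrightarrow> (\<exists>j\<in>{1..<k}. saturated t j \<and> infnorm (x k t - x j t) \<le> \<delta> t)"

definition small_gap :: "nat \<Rightarrow> nat \<Rightarrow> bool" where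
  "small_gap t k \<longleftrightarrow>
     cost P t (x k t) \<le> model_cost P vl (k - 1) t (x k t) + ereal (\<epsilon> (t - 1))"

lemma eps_tol_last: "\<epsilon> (stages P - 1) = 0"
  by (simp add: eps_tol_def)

text \<open>The tolerances are defined by sums; this recursion is what the propagation of gaps produces.\<close>

lemma eps_tol_step:
  assumes "t \<in> {1..stages P - 1}"
  shows "\<epsilon> (t - 1) = (M t + Ml t) * \<delta> t + discount P * \<epsilon> t"
proof -
  define g where "g s \<tau> = (M (\<tau> + 1) + Ml (\<tau> + 1)) * \<delta> (\<tau> + 1) * discount P ^ (\<tau> - s)" for s \<tau>
  have "\<epsilon> (t - 1) = (\<Sum>\<tau>=t - 1..stages P - 2. g (t - 1) \<tau>)"
    using assms by (auto simp: eps_tol_def g_def)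
  also have "\<dots> = g (t - 1) (t - 1) + (\<Sum>\<tau>=t..stages P - 2. g (t - 1) \<tau>)"
    using assms by (subst sum.atLeast_Suc_atMost) auto
  also have "(\<Sum>\<tau>=t..stages P - 2. g (t - 1) \<tau>) = (\<Sum>\<tau>=t..stages P - 2. discount P * g t \<tau>)"
  proof (rule sum.cong)
    fix \<tau> assume "\<tau> \<in> {t..stages P - 2}"
    then have "\<tau> - (t - 1) = Suc (\<tau> - t)"
      using assms by auto
    then show "g (t - 1) \<tau> = discount P * g t \<tau>"
      by (simp add: g_def)
  qed simp
  also have "\<dots> = discount P * \<epsilon> t"
    using assms by (auto simp: eps_tol_def g_def sum_distrib_left)
  also have "g (t - 1) (t - 1) = (M t + Ml t) * \<delta> t"
    using assms by (simp add: g_def)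
  finally show ?thesis .
qed

lemma small_gap_last: "small_gap (stages P) k"
  unfolding small_gap_def
  by (simp add: cost_def model_cost_def value_after_last model_after_last eps_tol_last[simplified])

text \<open>
  The value function is at most the true cost of the iterate, which exceeds the approximate cost by
  at most the tolerance. The iterate minimises that approximate cost and the models increase, so
  the approximate cost is at most the height of the new cut at the point where it is built.
\<close>

lemma small_gap_imp_saturated:
  assumes "small_gap (Suc t) k" "1 \<le> k" "1 \<le> t" "t < stages P"
  shows "saturated t k"
proof -
  have t: "Suc t \<in> {1..stages P}" "Suc t \<in> {2..stages P}" using assms by auto
  have "value_fun P (Suc t) (x k t) \<le> cost P (Suc t) (x k (Suc t))"
    using t iterate_feas[OF assms(2) t(1)] by (subst value_fun_eq) (auto intro: INF_lower)
  also have "\<dots> \<le> model_cost P vl (k - 1) (Suc t) (x k (Suc t)) + ereal (\<epsilon> t)"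
    using assms(1) by (simp add: small_gap_def)
  also have "\<dots> \<le> (INF w\<in>feas P (Suc t) (x k t). model_cost P vl k (Suc t) w) + ereal (\<epsilon> t)"
  proof (intro add_right_mono INF_greatest)
    fix w assume "w \<in> feas P (Suc t) (x k t)"
    then have "model_cost P vl (k - 1) (Suc t) (x k (Suc t)) \<le> model_cost P vl (k - 1) (Suc t) w"
      using iterate_le[OF assms(2) t(1)] by simp
    also have "\<dots> \<le> model_cost P vl k (Suc t) w"
      by (rule model_cost_mono) (use t in auto)
    finally show "model_cost P vl (k - 1) (Suc t) (x k (Suc t)) \<le> model_cost P vl k (Suc t) w" .
  qed
  also have "\<dots> \<le> vl k (Suc t) (x k t) + ereal (\<epsilon> t)"
    using model_update[OF t(2) assms(2), of "x k t"] by (intro add_right_mono) simp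
  finally show ?thesis
    by (simp add: saturated_def)
qed

text \<open>
  Compare the two costs at the nearby saturated point, where they differ by at most
  \<open>\<lambda> \<epsilon>\<^sub>t\<close>, and move to the iterate: each of them changes by at most its Lipschitz constant times
  \<open>\<delta>\<^sub>t\<close>. The saturated point stays saturated for the later models, as these increase.
\<close>

lemma covered_imp_small_gap:
  assumes "covered t k" "t \<in> {1..stages P - 1}"
  shows "small_gap t k"
proof -
  from assms(1) obtain j where j: "1 \<le> j" "j < k" "saturated t j"
      and dist: "infnorm (x k t - x j t) \<le> \<delta> t"
    by (auto simp: covered_def)
  define p q where "p = x j t" and "q = x k t"
  have t: "t \<in> {1..stages P}" using assms by auto
  have k: "1 \<le> k - 1" "j \<le> k - 1" using j by auto
  have p: "p \<in> eff_region P t" and q: "q \<in> eff_region P t"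
    using iterate_in_region t j by (auto simp: p_def q_def)
  obtain cp cq mp mq hp vp lp where
    eqs: "cost P t p = ereal cp" "cost P t q = ereal cq"
      "model_cost P vl (k - 1) t p = ereal mp" "model_cost P vl (k - 1) t q = ereal mq"
      "obj P t p = ereal hp" "value_fun P (Suc t) p = ereal vp" "vl (k - 1) (Suc t) p = ereal lp"
    using cost_finite[OF t p] cost_finite[OF t q] model_cost_finite[OF t k(1) p]
      model_cost_finite[OF t k(1) q] obj_finite[OF t p] value_finite[OF t p]
      model_finite[OF t k(1) p]
    by (metis ereal_real')
  have "value_fun P (Suc t) p \<le> vl j (Suc t) p + ereal (\<epsilon> t)"
    using j(3) by (simp add: saturated_def p_def)
  also have "\<dots> \<le> vl (k - 1) (Suc t) p + ereal (\<epsilon> t)"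
    using model_mono[OF k(2)] t by (intro add_right_mono) auto
  finally have "vp \<le> lp + \<epsilon> t"
    by (simp only: eqs plus_ereal.simps ereal_less_eq)
  then have "discount P * vp \<le> discount P * (lp + \<epsilon> t)"
    using discount_pos by simp
  moreover have "cp = hp + discount P * vp" "mp = hp + discount P * lp"
    using eqs by (auto simp: cost_def model_cost_def)
  ultimately have at_p: "cp \<le> mp + discount P * \<epsilon> t"
    by (simp add: distrib_left)
  have "\<bar>cost P t q - cost P t p\<bar> \<le> ereal (M t * infnorm (q - p))" and "0 \<le> M t"
    and "\<bar>model_cost P vl (k - 1) t p - model_cost P vl (k - 1) t q\<bar> \<le> ereal (Ml t * infnorm (p - q))"
    and "0 \<le> Ml t"
    using cost_lipschitz[OF t] model_lipschitz[OF t k(1)] p q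
    unfolding infnorm_lipschitz_on_def by blast+
  moreover have "M t * infnorm (q - p) \<le> M t * \<delta> t" if "0 \<le> M t"
    using dist that by (intro mult_left_mono) (auto simp: p_def q_def)
  moreover have "Ml t * infnorm (p - q) \<le> Ml t * \<delta> t" if "0 \<le> Ml t"
    using dist that infnorm_sub[of p q] by (intro mult_left_mono) (auto simp: p_def q_def)
  ultimately have "\<bar>cq - cp\<bar> \<le> M t * \<delta> t" "\<bar>mp - mq\<bar> \<le> Ml t * \<delta> t"
    unfolding eqs by auto
  with at_p have "cq \<le> mq + \<epsilon> (t - 1)"
    unfolding eps_tol_step[OF assms(2)] distrib_right by linarith
  then show ?thesis
    unfolding small_gap_def q_def[symmetric] eqs by simp
qed

text \<open>
  The small gap needed at the following stage comes from covering or, if this is the last stage, from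
  the equality of both costs there.
\<close>

lemma uncovered_stage_saturated:
  assumes "1 \<le> k" "t \<in> {1..stages P - 1}" "\<And>s. t < s \<Longrightarrow> s < stages P \<Longrightarrow> covered s k"
  shows "saturated t k"
proof (rule small_gap_imp_saturated)
  show "small_gap (Suc t) k"
  proof (cases "Suc t = stages P")
    case True
    then show ?thesis using small_gap_last[of k] by simp
  next
    case False
    then show ?thesis
      using assms covered_imp_small_gap[of "Suc t" k] by auto
  qed
qed (use assms in auto)

section \<open>Covered iterations meet both termination criteria\<close>

definition all_covered :: "nat \<Rightarrow> bool" where
  "all_covered k \<longleftrightarrow> 1 \<le> k \<and> (\<forall>t\<in>{1..stages P - 1}. covered t k)"

lemma iterate_policy_feasible: "1 \<le> k \<Longrightarrow> feasible_policy P (x k)"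
  using iterate_feas by (simp add: feasible_policy_def)

text \<open>
  The first iteration has no predecessor that could cover it. So the models entering a covered
  iteration are those of an iteration with Lipschitz, hence finite, approximate costs.
\<close>

lemma all_covered_imp_ge_2:
  assumes "all_covered k"
  shows "2 \<le> k"
proof -
  have "covered 1 k"
    using assms stages_ge_2 by (auto simp: all_covered_def)
  then show ?thesis
    by (auto simp: covered_def)
qed

lemma all_covered_imp_small_gap:
  assumes "all_covered k" "t \<in> {1..stages P}"
  shows "small_gap t k"
proof (cases "t = stages P")
  case True
  then show ?thesis using small_gap_last by simp
next
  case False
  then show ?thesis
    using assms covered_imp_small_gap[of t k] by (auto simp: all_covered_def)
qed

lemma first_stage_gap_le:
  assumes "all_covered k"
  shows "cost P 1 (x k 1) - opt_value P \<le> ereal (\<epsilon> 0)"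
proof -
  have k: "2 \<le> k" using assms by (rule all_covered_imp_ge_2)
  have 1: "1 \<in> {1..stages P}" using stages_ge_2 by simp
  have "opt_value P = value_fun P 1 0"
    using 1 by (subst value_fun_eq) (auto simp: opt_value_def)
  then have lower: "model_cost P vl (k - 1) 1 (x k 1) \<le> opt_value P"
    using iterate_model_cost_le_value[OF _ 1 _ feas_first_stage, of k 0] k by simp
  have reg: "x k 1 \<in> eff_region P 1"
    by (rule iterate_in_region[OF _ 1]) (use k in simp)
  obtain c m where c: "cost P 1 (x k 1) = ereal c" and m: "model_cost P vl (k - 1) 1 (x k 1) = ereal m"
    using cost_finite[OF 1 reg] model_cost_finite[OF 1 _ reg, of "k - 1"] k by fastforce
  have "c \<le> m + \<epsilon> 0"
    using all_covered_imp_small_gap[OF assms 1] c m by (simp add: small_gap_def)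
  with lower show ?thesis
    unfolding c m by (cases "opt_value P") auto
qed

text \<open>
  At every stage the objective is the cost minus the discounted next value, and the latter is at
  least the next stage's approximate cost. Replacing the cost by the approximate cost plus the
  tolerance leaves a telescoping sum.
\<close>

lemma policy_gap_le:
  assumes "all_covered k"
  shows "policy_gap P x vl k \<le> ereal (\<Sum>t=1..stages P. discount P ^ (t - 1) * \<epsilon> (t - 1))"
proof -
  have k: "2 \<le> k" using assms by (rule all_covered_imp_ge_2)
  define h where "h t = real_of_ereal (obj P t (x k t))" for t
  \<comment> \<open>There is no approximate cost after the last stage; the value 0 ends the telescoping sum.\<close>
  define m where
    "m t = (if t \<le> stages P then real_of_ereal (model_cost P vl (k - 1) t (x k t)) else 0)" for t
  have reg: "x k t \<in> eff_region P t" if "t \<in> {1..stages P}" for t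
    using iterate_in_region k that by simp
  have h: "obj P t (x k t) = ereal (h t)" if "t \<in> {1..stages P}" for t
    using obj_finite[OF that reg[OF that]] by (simp add: h_def ereal_real')
  have m: "model_cost P vl (k - 1) t (x k t) = ereal (m t)" if "t \<in> {1..stages P}" for t
    using model_cost_finite[OF that _ reg[OF that], of "k - 1"] k that
    by (simp add: m_def ereal_real')
  have step: "h t \<le> m t + \<epsilon> (t - 1) - discount P * m (Suc t)" if t: "t \<in> {1..stages P}" for t
  proof -
    obtain v where v: "value_fun P (Suc t) (x k t) = ereal v"
      using value_finite[OF t reg[OF t]] by fastforce
    have "m (Suc t) \<le> v"
    proof (cases "t = stages P")
      case True
      then show ?thesis using v by (simp add: m_def value_after_last)
    next
      case False
      then have "Suc t \<in> {1..stages P}" using t by simp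
      then show ?thesis
        using iterate_model_cost_le_value[of k "Suc t" "x k t"] k reg[OF t] m[of "Suc t"] v by simp
    qed
    then have "discount P * m (Suc t) \<le> discount P * v"
      using discount_pos by simp
    moreover have "h t + discount P * v \<le> m t + \<epsilon> (t - 1)"
      using all_covered_imp_small_gap[OF assms t]
      by (simp only: small_gap_def cost_def h[OF t] m[OF t] v plus_ereal.simps times_ereal.simps
          ereal_less_eq)
    ultimately show ?thesis by simp
  qed
  have "(\<Sum>t=1..stages P. discount P ^ (t - 1) * h t)
     \<le> (\<Sum>t=1..stages P. discount P ^ (t - 1) * \<epsilon> (t - 1)
          - (discount P ^ (Suc t - 1) * m (Suc t) - discount P ^ (t - 1) * m t))"
  proof (rule sum_mono)
    fix t assume t: "t \<in> {1..stages P}"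
    have "discount P ^ (t - 1) * h t
       \<le> discount P ^ (t - 1) * (m t + \<epsilon> (t - 1) - discount P * m (Suc t))"
      using step[OF t] discount_pos by (intro mult_left_mono) auto
    moreover have "discount P ^ (Suc t - 1) = discount P ^ (t - 1) * discount P"
      using t by (cases t) auto
    ultimately show "discount P ^ (t - 1) * h t \<le> discount P ^ (t - 1) * \<epsilon> (t - 1)
        - (discount P ^ (Suc t - 1) * m (Suc t) - discount P ^ (t - 1) * m t)"
      by (simp add: algebra_simps)
  qed
  also have "\<dots> = (\<Sum>t=1..stages P. discount P ^ (t - 1) * \<epsilon> (t - 1)) + m 1"
    unfolding sum_subtractf[of "\<lambda>t. discount P ^ (t - 1) * \<epsilon> (t - 1)"]
    by (subst sum_Suc_diff) (use stages_ge_2 in \<open>auto simp: m_def\<close>)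
  finally have "(\<Sum>t=1..stages P. discount P ^ (t - 1) * h t) - m 1
     \<le> (\<Sum>t=1..stages P. discount P ^ (t - 1) * \<epsilon> (t - 1))" by simp
  moreover have "policy_gap P x vl k = ereal ((\<Sum>t=1..stages P. discount P ^ (t - 1) * h t) - m 1)"
    using stages_ge_2 m[of 1] by (simp add: policy_gap_def h)
  ultimately show ?thesis by simp
qed

section \<open>Counting the uncovered iterations\<close>

text \<open>
  Two such iterates are far apart because the later one is not covered by the earlier one, so the
  packing bound applies.
\<close>

lemma new_saturated_bound:
  assumes t: "t \<in> {1..stages P}" and \<delta>: "0 < \<delta> t"
  defines "N \<equiv> {k. 1 \<le> k \<and> saturated t k \<and> \<not> covered t k}"
  shows "finite N \<and> real (card N) \<le> (D t / \<delta> t + 1) ^ stage_dim P t"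
proof -
  have sep: "\<delta> t < infnorm (x k t - x j t)" if "k \<in> N" "j \<in> N" "k \<noteq> j" for k j
  proof (cases "j < k")
    case True
    then show ?thesis using that by (auto simp: N_def covered_def)
  next
    case False
    then have "\<delta> t < infnorm (x j t - x k t)"
      using that by (auto simp: N_def covered_def)
    then show ?thesis by (simp add: infnorm_sub)
  qed
  have inj: "inj_on (\<lambda>k. x k t) N"
    by (rule inj_onI, rule ccontr) (use sep \<delta> in \<open>fastforce simp: infnorm_0\<close>)
  have sub: "(\<lambda>k. x k t) ` N \<subseteq> eff_region P t"
    using iterate_in_region t by (auto simp: N_def)
  have "finite ((\<lambda>k. x k t) ` N)
      \<and> real (card ((\<lambda>k. x k t) ` N)) \<le> (D t / \<delta> t + 1) ^ card (coords P t)"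
  proof (rule card_separated_le)
    show "coords P t \<subseteq> Basis"
      using problem t by (simp add: convex_multistage_def)
    show "(\<lambda>k. x k t) ` N \<subseteq> span (coords P t)"
      using sub region_subset_span[OF t] by blast
    show "0 \<le> D t"
      using bounded t by (simp add: bounded_regions_def)
    show "infnorm (a - b) \<le> D t" if "a \<in> (\<lambda>k. x k t) ` N" "b \<in> (\<lambda>k. x k t) ` N" for a b
      using bounded t that sub unfolding bounded_regions_def by blast
    show "\<delta> t < infnorm (a - b)"
      if "a \<in> (\<lambda>k. x k t) ` N" "b \<in> (\<lambda>k. x k t) ` N" "a \<noteq> b" for a b
      using that sep by blast
  qed (rule \<delta>)
  then show ?thesis
    using inj by (simp add: card_image finite_image_iff stage_dim_def)
qed

text \<open>
  Every iteration that is not covered belongs to the finite set counted above for some stage, namely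
  for the last stage that is not covered.
\<close>

lemma exists_all_covered:
  assumes \<delta>: "\<And>t. t \<in> {1..stages P - 1} \<Longrightarrow> 0 < \<delta> t"
  shows "\<exists>k. all_covered k \<and>
    real k \<le> (\<Sum>t=1..stages P - 1. (D t / \<delta> t + 1) ^ stage_dim P t) + 1"
proof -
  define N where "N t = {k. 1 \<le> k \<and> saturated t k \<and> \<not> covered t k}" for t
  have N: "finite (N t)" "real (card (N t)) \<le> (D t / \<delta> t + 1) ^ stage_dim P t"
    if "t \<in> {1..stages P - 1}" for t
    using new_saturated_bound[of t] \<delta>[OF that] that by (auto simp: N_def)
  define U where "U = (\<Union>t\<in>{1..stages P - 1}. N t)"
  have finU: "finite U"
    using N by (auto simp: U_def)
  have "\<not> {1..Suc (card U)} \<subseteq> U"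
    using card_mono[OF finU, of "{1..Suc (card U)}"] by auto
  then obtain k where k: "1 \<le> k" "k \<le> Suc (card U)" "k \<notin> U"
    unfolding subset_iff atLeastAtMost_iff by blast
  have "all_covered k"
  proof (rule ccontr)
    assume "\<not> all_covered k"
    then have ne: "{t \<in> {1..stages P - 1}. \<not> covered t k} \<noteq> {}" (is "?B \<noteq> {}")
      using k by (auto simp: all_covered_def)
    define t where "t = Max ?B"
    have "t \<in> ?B"
      unfolding t_def using ne by (intro Max_in) auto
    then have t: "t \<in> {1..stages P - 1}" "\<not> covered t k" by auto
    have "covered s k" if "t < s" "s < stages P" for s
    proof (rule ccontr)
      assume "\<not> covered s k"
      then have "s \<in> ?B" using that by auto
      then have "s \<le> t" unfolding t_def by (intro Max_ge) auto
      with that show False by simp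
    qed
    then have "saturated t k"
      using uncovered_stage_saturated k t by blast
    with t k show False by (auto simp: U_def N_def)
  qed
  moreover have "real (card U) \<le> (\<Sum>t=1..stages P - 1. (D t / \<delta> t + 1) ^ stage_dim P t)"
  proof -
    have "card U \<le> (\<Sum>t=1..stages P - 1. card (N t))"
      unfolding U_def by (rule card_UN_le) simp
    then have "real (card U) \<le> (\<Sum>t=1..stages P - 1. real (card (N t)))"
      by (simp flip: of_nat_sum)
    also have "\<dots> \<le> (\<Sum>t=1..stages P - 1. (D t / \<delta> t + 1) ^ stage_dim P t)"
      using N by (intro sum_mono) auto
    finally show ?thesis .
  qed
  ultimately show ?thesis using k by force
qed

section \<open>Uniform tolerances\<close>

lemma eps_tol_le_geometric:
  assumes M: "\<And>t. t \<in> {1..stages P} \<Longrightarrow> M t \<le> m \<and> Ml t \<le> m"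
    and \<delta>: "\<And>t. t \<in> {1..stages P} \<Longrightarrow> \<delta> t = e"
    and s: "s \<le> stages P - 1"
  shows "\<epsilon> s \<le> 2 * m * e * (\<Sum>i<stages P - 1 - s. discount P ^ i)"
  using s
proof (induction s rule: inc_induct)
  case base
  show ?case by (simp add: eps_tol_last[simplified])
next
  case (step s)
  have t: "Suc s \<in> {1..stages P - 1}" "Suc s \<in> {1..stages P}"
    using step.hyps by auto
  have n: "stages P - 1 - s = Suc (stages P - 1 - Suc s)"
    using step.hyps by simp
  have e: "0 \<le> e"
    using \<delta>_nonneg[OF t(2)] \<delta>[OF t(2)] by simp
  have "\<epsilon> s = (M (Suc s) + Ml (Suc s)) * e + discount P * \<epsilon> (Suc s)"
    using eps_tol_step[OF t(1)] \<delta>[OF t(2)] by simp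
  also have "\<dots> \<le> (2 * m) * e
      + discount P * (2 * m * e * (\<Sum>i<stages P - 1 - Suc s. discount P ^ i))"
    using M[OF t(2)] e discount_pos step.IH by (intro add_mono mult_right_mono mult_left_mono) auto
  also have "\<dots> = 2 * m * e * (\<Sum>i<stages P - 1 - s. discount P ^ i)"
    unfolding n by (simp only: sum.lessThan_Suc_shift)
      (simp add: sum_distrib_left algebra_simps)
  finally show ?case .
qed

text \<open>
  A partial geometric sum is bounded by the number of its terms and, for a discount factor below 1,
  by the sum of the whole series; the minima come from using both. At discount factor 1 the
  quotients are infinite as extended reals, so that the minima select the first bound.
\<close>

lemma uniform_tolerances:
  assumes M: "\<And>t. t \<in> {1..stages P} \<Longrightarrow> M t \<le> m \<and> Ml t \<le> m"
    and \<delta>: "\<And>t. t \<in> {1..stages P} \<Longrightarrow> \<delta> t = e"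
  shows "ereal (\<epsilon> 0)
      \<le> ereal (2 * m) * min (1 / ereal (1 - discount P)) (ereal (real (stages P - 1))) * ereal e"
      (is "_ \<le> ?b1")
    and "ereal (\<Sum>t=1..stages P. discount P ^ (t - 1) * \<epsilon> (t - 1))
      \<le> ereal (2 * m) * min (1 / ereal ((1 - discount P)\<^sup>2))
          (ereal (real (stages P * (stages P - 1)) / 2)) * ereal e"
      (is "_ \<le> ?b2")
proof -
  let ?q = "discount P"
  let ?n = "stages P"
  define g where "g k = (\<Sum>i<k. ?q ^ i)" for k
  define G where "G = (\<Sum>s<?n. ?q ^ s * g (?n - 1 - s))"
  have 1: "1 \<in> {1..?n}" using stages_ge_2 by simp
  have "0 \<le> M 1"
    using cost_lipschitz[OF 1] by (simp add: infnorm_lipschitz_on_def)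
  then have me: "0 \<le> 2 * m * e"
    using M[OF 1] \<delta>[OF 1] \<delta>_nonneg[OF 1] by (intro mult_nonneg_nonneg) auto
  have q: "0 < ?q" "?q \<le> 1"
    by (fact discount_pos, fact discount_le_1)
  have g1: "g k \<le> real k" and g2: "?q < 1 \<Longrightarrow> g k \<le> 1 / (1 - ?q)" for k
    using geometric_sum_le[of ?q k] q by (auto simp: g_def)
  have g_nonneg: "0 \<le> g k" for k
    using q by (auto simp: g_def intro!: sum_nonneg)
  have eps: "\<epsilon> s \<le> 2 * m * e * g (?n - 1 - s)" if "s \<le> ?n - 1" for s
    using eps_tol_le_geometric[OF M \<delta> that] by (simp add: g_def)
  have G1: "G \<le> real (?n * (?n - 1)) / 2"
  proof -
    have "G \<le> (\<Sum>s<?n. real (?n - 1 - s))"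
      unfolding G_def
    proof (rule sum_mono)
      fix s
      have "?q ^ s * g (?n - 1 - s) \<le> 1 * real (?n - 1 - s)"
        using q g1 g_nonneg by (intro mult_mono power_le_one) auto
      then show "?q ^ s * g (?n - 1 - s) \<le> real (?n - 1 - s)" by simp
    qed
    then show ?thesis by (simp only: sum_countdown)
  qed
  have G2: "G \<le> 1 / (1 - ?q)\<^sup>2" if "?q < 1"
  proof -
    have "G \<le> (\<Sum>s<?n. ?q ^ s * (1 / (1 - ?q)))"
      unfolding G_def using g2[OF that] q by (intro sum_mono mult_left_mono) auto
    also have "\<dots> = g ?n * (1 / (1 - ?q))"
      by (simp only: g_def sum_distrib_right)
    also have "\<dots> \<le> 1 / (1 - ?q) * (1 / (1 - ?q))"
      using g2[OF that] that by (intro mult_right_mono) auto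
    finally show ?thesis by (simp add: power2_eq_square)
  qed
  have min: "min (1 / ereal p) (ereal c) = ereal (if p = 0 then c else min (1 / p) c)" for p c
    by (auto simp: one_ereal_def min_def)
  have "\<epsilon> 0 \<le> 2 * m * e * g (?n - 1)"
    using eps[of 0] by simp
  also have "\<dots> \<le> 2 * m * e * (if 1 - ?q = 0 then real (?n - 1)
      else min (1 / (1 - ?q)) (real (?n - 1)))"
    using me g1 g2 q by (intro mult_left_mono) auto
  finally show "ereal (\<epsilon> 0) \<le> ?b1"
    unfolding min by (simp only: times_ereal.simps ereal_less_eq mult_ac)
  have "(\<Sum>t=1..?n. ?q ^ (t - 1) * \<epsilon> (t - 1)) = (\<Sum>s<?n. ?q ^ s * \<epsilon> s)"
    unfolding One_nat_def by (subst sum.atLeast1_atMost_eq) simp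
  also have "\<dots> \<le> (\<Sum>s<?n. ?q ^ s * (2 * m * e * g (?n - 1 - s)))"
    using eps q by (intro sum_mono mult_left_mono) auto
  also have "\<dots> = 2 * m * e * G"
    unfolding G_def sum_distrib_left by (simp only: mult_ac)
  also have "\<dots> \<le> 2 * m * e * (if (1 - ?q)\<^sup>2 = 0 then real (?n * (?n - 1)) / 2
      else min (1 / (1 - ?q)\<^sup>2) (real (?n * (?n - 1)) / 2))"
    using me G1 G2 q by (intro mult_left_mono) auto
  finally show "ereal (\<Sum>t=1..?n. ?q ^ (t - 1) * \<epsilon> (t - 1)) \<le> ?b2"
    unfolding min by (simp only: times_ereal.simps ereal_less_eq mult_ac)
qed

end

section \<open>The iteration complexity\<close>

theorem theorem1:
  fixes P :: "'a::euclidean_space multistage"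
    and D M Ml \<delta> :: "nat \<Rightarrow> real"
    and x :: "nat \<Rightarrow> nat \<Rightarrow> 'a"
    and y z :: "nat \<Rightarrow> nat \<Rightarrow> nat \<Rightarrow> real"
    and vl :: "nat \<Rightarrow> nat \<Rightarrow> 'a \<Rightarrow> ereal"
  assumes "convex_multistage P"
    and "bounded_regions P D"
    and "regular_recourse P"
    and "\<forall>t\<in>{1..stages P}. infnorm_lipschitz_on (eff_region P t) (M t) (cost P t)"
    and "ddp_run P x y z vl"
    and "\<forall>t\<in>{1..stages P}. \<forall>k\<ge>1.
           infnorm_lipschitz_on (eff_region P t) (Ml t) (model_cost P vl k t)"
    and "\<forall>t\<in>{1..stages P}. 0 \<le> \<delta> t"
  shows
    "iterations_until
       (\<lambda>k. feasible_policy P (x k) \<and>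
            cost P 1 (x k 1) - opt_value P \<le> ereal (eps_tol P M Ml \<delta> 0) \<and>
            policy_gap P x vl k
              \<le> ereal (\<Sum>t=1..stages P. discount P ^ (t - 1) * eps_tol P M Ml \<delta> (t - 1)))
       \<le> iteration_bound P D \<delta>
     \<and>
     (\<forall>(n::nat) (Dmax::real) (Mmax::real) (\<epsilon>::real).
        0 < \<epsilon> \<longrightarrow>
        (\<forall>t\<in>{1..stages P}. stage_dim P t \<le> n \<and> D t \<le> Dmax \<and> max (M t) (Ml t) \<le> Mmax \<and> \<delta> t = \<epsilon>) \<longrightarrow>
        (\<exists>k\<ge>1.
           real k \<le> real (stages P - 1) * (Dmax / \<epsilon> + 1) ^ n + 1 \<and>
           feasible_policy P (x k) \<and>
           cost P 1 (x k 1) - opt_value P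
             \<le> ereal (2 * Mmax)
               * min (1 / ereal (1 - discount P)) (ereal (real (stages P - 1))) * ereal \<epsilon> \<and>
           policy_gap P x vl k
             \<le> ereal (2 * Mmax)
               * min (1 / ereal ((1 - discount P)\<^sup>2))
                     (ereal (real (stages P * (stages P - 1)) / 2)) * ereal \<epsilon>))"
proof (intro conjI allI impI)
  interpret ddp_method P D M Ml \<delta> x y z vl
    using assms(1,2,4-7) by unfold_locales auto
  show "iterations_until
       (\<lambda>k. feasible_policy P (x k) \<and>
            cost P 1 (x k 1) - opt_value P \<le> ereal (eps_tol P M Ml \<delta> 0) \<and>
            policy_gap P x vl k
              \<le> ereal (\<Sum>t=1..stages P. discount P ^ (t - 1) * eps_tol P M Ml \<delta> (t - 1)))
       \<le> iteration_bound P D \<delta>"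
  proof (cases "\<exists>t\<in>{1..stages P - 1}. \<delta> t = 0")
    case True
    then show ?thesis by (simp add: iteration_bound_def)
  next
    case False
    have "0 < \<delta> t" if "t \<in> {1..stages P - 1}" for t
      using False that \<delta>_nonneg[of t] by (force simp: order_less_le)
    then obtain k where k: "all_covered k"
        "real k \<le> (\<Sum>t=1..stages P - 1. (D t / \<delta> t + 1) ^ stage_dim P t) + 1"
      using exists_all_covered by blast
    then have k1: "1 \<le> k" by (simp add: all_covered_def)
    show ?thesis
      unfolding iterations_until_def
    proof (rule INF_lower2)
      show "k \<in> {k. 1 \<le> k \<and> feasible_policy P (x k) \<and>
            cost P 1 (x k 1) - opt_value P \<le> ereal (eps_tol P M Ml \<delta> 0) \<and>
            policy_gap P x vl k
              \<le> ereal (\<Sum>t=1..stages P. discount P ^ (t - 1) * eps_tol P M Ml \<delta> (t - 1))}"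
        using k1 iterate_policy_feasible first_stage_gap_le[OF k(1)] policy_gap_le[OF k(1)] by simp
      show "ereal (real k) \<le> iteration_bound P D \<delta>"
        unfolding iteration_bound_def using False k(2) by (simp only: if_False ereal_less_eq)
    qed
  qed
  fix n :: nat and Dmax Mmax \<epsilon> :: real
  assume \<epsilon>: "0 < \<epsilon>"
    and unif: "\<forall>t\<in>{1..stages P}. stage_dim P t \<le> n \<and> D t \<le> Dmax \<and> max (M t) (Ml t) \<le> Mmax \<and> \<delta> t = \<epsilon>"
  have "0 < \<delta> t" if "t \<in> {1..stages P - 1}" for t
    using unif that \<epsilon> by auto
  then obtain k where k: "all_covered k"
      "real k \<le> (\<Sum>t=1..stages P - 1. (D t / \<delta> t + 1) ^ stage_dim P t) + 1"
    using exists_all_covered by blast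
  have "(\<Sum>t=1..stages P - 1. (D t / \<delta> t + 1) ^ stage_dim P t)
      \<le> (\<Sum>t=1..stages P - 1. (Dmax / \<epsilon> + 1) ^ n)"
  proof (rule sum_mono)
    fix t assume "t \<in> {1..stages P - 1}"
    then have t: "t \<in> {1..stages P}" by auto
    have D: "0 \<le> D t" "D t \<le> Dmax"
      using bounded unif t by (auto simp: bounded_regions_def)
    have "(D t / \<delta> t + 1) ^ stage_dim P t \<le> (Dmax / \<epsilon> + 1) ^ stage_dim P t"
      using D \<epsilon> unif t by (intro power_mono add_mono) (auto intro: divide_right_mono)
    also have "\<dots> \<le> (Dmax / \<epsilon> + 1) ^ n"
    proof (rule power_increasing)
      show "1 \<le> Dmax / \<epsilon> + 1"
        using order_trans[OF D] \<epsilon> by simp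
    qed (use unif t in blast)
    finally show "(D t / \<delta> t + 1) ^ stage_dim P t \<le> (Dmax / \<epsilon> + 1) ^ n" .
  qed
  with k(2) have bound: "real k \<le> real (stages P - 1) * (Dmax / \<epsilon> + 1) ^ n + 1"
    by simp
  have M: "M t \<le> Mmax \<and> Ml t \<le> Mmax" and \<delta>: "\<delta> t = \<epsilon>" if "t \<in> {1..stages P}" for t
    using unif that by auto
  have k1: "1 \<le> k"
    using k(1) by (simp add: all_covered_def)
  show "\<exists>k\<ge>1.
           real k \<le> real (stages P - 1) * (Dmax / \<epsilon> + 1) ^ n + 1 \<and>
           feasible_policy P (x k) \<and>
           cost P 1 (x k 1) - opt_value P
             \<le> ereal (2 * Mmax)
               * min (1 / ereal (1 - discount P)) (ereal (real (stages P - 1))) * ereal \<epsilon> \<and>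
           policy_gap P x vl k
             \<le> ereal (2 * Mmax)
               * min (1 / ereal ((1 - discount P)\<^sup>2))
                     (ereal (real (stages P * (stages P - 1)) / 2)) * ereal \<epsilon>"
    using k1 bound iterate_policy_feasible[OF k1]
      order_trans[OF first_stage_gap_le[OF k(1)] uniform_tolerances(1)[OF M \<delta>]]
      order_trans[OF policy_gap_le[OF k(1)] uniform_tolerances(2)[OF M \<delta>]]
    by blast
qed

end
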